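(* Let $\mathcal{A}$ be a union-closed family of subsets of $\{1,\ldots,9\}$ that contains at least one non-empty set. Then there exists an element $x \in \{1,\ldots,9\}$ belonging to at least half of the sets of $\mathcal{A}$, that is, $2\,|\{A \in \mathcal{A} : x \in A\}| \geq |\mathcal{A}|$.
   Context: A family $\mathcal{A}$ of sets is union-closed if $A \cup B \in \mathcal{A}$ for all $A,B \in \mathcal{A}$. *)

theory Defs
  imports Main
begin

definition union_closed :: "'a set set \<Rightarrow> bool" where
  "union_closed \<A> \<longleftrightarrow> (\<forall>A\<in>\<A>. \<forall>B\<in>\<A>. A \<union> B \<in> \<A>)"

end

theory Submission
  imports Defs
begin

text \<open>
  Suppose every element is rare and the empty set belongs to the family \<open>\<A>\<close>. Then for all nonnegative
  integer weights \<open>w\<close> on the ground set \<open>X\<close> one has \<open>(\<Sum>A\<in>\<A>. 2 * w A - w X) \<le> - w X\<close>. Splitting \<open>\<A>\<close>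
  according to the trace \<open>L\<close> of its members outside a set \<open>P\<close> turns the left-hand side into a sum over
  union-closed families on \<open>P\<close>, and suitable weights contradict the bound. Let \<open>F\<close> be a
  smallest nonempty member. Sizes 1 and 2 are excluded by weights on \<open>F\<close>, size at least 5 by uniform
  weights, size 4 by weight 3 on \<open>F\<close> and 1 elsewhere. If \<open>F\<close> has size 3, weight 5 on \<open>F\<close> and 1
  elsewhere forces at least five 3-sets disjoint from \<open>F\<close> when \<open>X\<close> has 9 elements (three such sets
  for smaller \<open>X\<close>), so some 5-set contains three 3-sets of \<open>\<A>\<close>. Up to isomorphism there are four
  such triples, and for each of them weights as in Poonen's criterion for FC-families exclude it.
\<close>

section \<open>Weight inequalities on small cubes\<close>

text \<open>
  A family of subsets of a \<open>k\<close>-set is encoded by its indicator \<open>y\<close>, where the set bits of \<open>n\<close> are the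
  elements of the subset. Closure under unions is stated linearly in \<open>y\<close> so that the weight
  inequalities below become linear programming bounds; \<open>G\<close> lists subsets that are unioned into
  arbitrary members. In \<open>fc_weighting\<close>, \<open>c\<close> stands for half the total weight.
\<close>

definition bit_closed :: "(nat \<Rightarrow> int) \<Rightarrow> nat set \<Rightarrow> bool" where
  "bit_closed y G \<longleftrightarrow> (\<forall>n. y n \<in> {0, 1}) \<and> (\<forall>m n. y m + y n \<le> 1 + y (or m n))
    \<and> (\<forall>f\<in>G. \<forall>n. y n \<le> y (or n f))"

lemma bit_closed_values: "bit_closed y G \<Longrightarrow> y n = 0 \<or> y n = 1"
  by (simp add: bit_closed_def)

lemma bit_closed_nonneg: "bit_closed y G \<Longrightarrow> 0 \<le> y n"
  using bit_closed_values[of y G n] by auto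

lemma bit_closed_le_1: "bit_closed y G \<Longrightarrow> y n \<le> 1"
  using bit_closed_values[of y G n] by auto

lemma bit_closed_or: "bit_closed y G \<Longrightarrow> y m + y n \<le> 1 + y (or m n)"
  by (simp add: bit_closed_def)

lemma bit_closed_gen: "bit_closed y G \<Longrightarrow> f \<in> G \<Longrightarrow> y n \<le> y (or n f)"
  by (simp add: bit_closed_def)

definition fc_weighting :: "nat \<Rightarrow> nat set \<Rightarrow> int list \<Rightarrow> int \<Rightarrow> bool" where
  "fc_weighting k G w c \<longleftrightarrow> (\<forall>y. bit_closed y G \<longrightarrow>
    0 \<le> (\<Sum>n<2 ^ k. y n * ((\<Sum>i<k. w ! i * of_bool (bit n i)) - c)))"

lemma fc_weightingI:
  "(\<And>y. bit_closed y G \<Longrightarrow> 0 \<le> (\<Sum>n<2 ^ k. y n * ((\<Sum>i<k. w ! i * of_bool (bit n i)) - c)))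
    \<Longrightarrow> fc_weighting k G w c"
  by (simp add: fc_weighting_def)

section \<open>Weightings for six generating configurations\<close>

lemmas cube_sum_simps = lessThan_nat_numeral lessThan_Suc bit_Suc_0_iff

lemma fc_weighting_singleton: "fc_weighting 1 {1} [2] 1"
proof (rule fc_weightingI)
  fix y assume y: "bit_closed y {1}"
  show "0 \<le> (\<Sum>n<2 ^ 1. y n * ((\<Sum>i<1. [2] ! i * of_bool (bit n i)) - 1))"
    by (simp add: cube_sum_simps) (use bit_closed_gen[OF y, of 1 0] in simp)
qed

lemma fc_weighting_pair: "fc_weighting 2 {3} [1, 1] 1"
proof (rule fc_weightingI)
  fix y assume y: "bit_closed y {3}"
  show "0 \<le> (\<Sum>n<2 ^ 2. y n * ((\<Sum>i<2. [1, 1] ! i * of_bool (bit n i)) - 1))"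
    by (simp add: cube_sum_simps) (use bit_closed_gen[OF y, of 3 0] in simp)
qed

text \<open>
  Each list \<open>facts\<close> is the support of a Farkas certificate for the inequality. The case split on \<open>y 7\<close>
  is needed because the linear relaxation alone does not imply it.
\<close>

lemma fc_weighting_star: "fc_weighting 4 {7, 11, 13} [1, 1, 1, 1] 2"
proof (rule fc_weightingI)
  fix y assume y: "bit_closed y {7, 11, 13}"
  note cl = bit_closed_or[OF y] and F = bit_closed_gen[OF y]
    and lo = bit_closed_nonneg[OF y] and hi = bit_closed_le_1[OF y]
  note facts = F[of 11 0] F[of 13 1] F[of 7 2] F[of 11 2] F[of 7 4] cl[of 8 2] F[of 11 8] cl[of 10 4]
      F[of 7 11] lo[of 14]
  show "0 \<le> (\<Sum>n<2 ^ 4. y n * ((\<Sum>i<4. [1, 1, 1, 1] ! i * of_bool (bit n i)) - 2))"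
    by (simp add: cube_sum_simps) (use facts[simplified] in linarith)
qed

text \<open>For elements a to e at bit positions 0 to 4 the generators are abc, ade and abd. Each
  weight is one more than the number of generators containing the element.\<close>

lemma fc_weighting_path: "fc_weighting 5 {7, 25, 11} [4, 3, 2, 3, 2] 7"
proof (rule fc_weightingI)
  fix y assume y: "bit_closed y {7, 25, 11}"
  note cl = bit_closed_or[OF y] and F = bit_closed_gen[OF y]
    and lo = bit_closed_nonneg[OF y] and hi = bit_closed_le_1[OF y]
  show "0 \<le> (\<Sum>n<2 ^ 5. y n * ((\<Sum>i<5. [4, 3, 2, 3, 2] ! i * of_bool (bit n i)) - 7))"
  \<comment> \<open>If the generator 7 is absent from the family, closure under it removes all of
    its subsets. If it is present, uniting it with the other two generators puts 15 and 31 into the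
    family.\<close>
  proof (cases "y 7 = 0")
    case True
    note facts = F[of 7 0] F[of 7 1] F[of 7 2] F[of 7 4] F[of 7 5] F[of 7 6] F[of 7 8] F[of 7 10] F[of 25 12]
      F[of 7 16] F[of 11 17] F[of 7 18] F[of 11 20] F[of 25 23] F[of 25 24] lo[of 11] lo[of 13]
      lo[of 14] lo[of 19] lo[of 21] lo[of 26] lo[of 27] lo[of 29] lo[of 30] lo[of 31]
    show ?thesis
      by (simp add: cube_sum_simps) (use facts[simplified] True in linarith)
  next
    case False
    then have "y 7 = 1"
      using bit_closed_values[OF y, of 7] by blast
    note facts = F[of 11 0] F[of 7 2] F[of 25 2] cl[of 4 2] F[of 25 4] F[of 11 7] F[of 25 7] cl[of 8 2]
      cl[of 8 5] cl[of 8 6] F[of 25 10] F[of 25 11] cl[of 12 1] cl[of 12 2] cl[of 16 10]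
      F[of 7 16] cl[of 17 4] cl[of 18 1] cl[of 20 14] cl[of 20 17] F[of 25 24] lo[of 30]
    show ?thesis
      by (simp add: cube_sum_simps) (use facts[simplified] \<open>y 7 = 1\<close> in linarith)
  qed
qed

text \<open>The generators are abc, ade and bcd, so the third one avoids the point shared by the
  first two. Each weight is twice the number of generators containing the element.\<close>

lemma fc_weighting_split: "fc_weighting 5 {7, 25, 14} [4, 4, 4, 4, 2] 9"
proof (rule fc_weightingI)
  fix y assume y: "bit_closed y {7, 25, 14}"
  note cl = bit_closed_or[OF y] and F = bit_closed_gen[OF y]
    and lo = bit_closed_nonneg[OF y] and hi = bit_closed_le_1[OF y]
  show "0 \<le> (\<Sum>n<2 ^ 5. y n * ((\<Sum>i<5. [4, 4, 4, 4, 2] ! i * of_bool (bit n i)) - 9))"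
  proof (cases "y 7 = 0")
    case True
    note facts = F[of 7 0] F[of 7 1] F[of 7 2] F[of 7 3] F[of 7 4] F[of 7 5] F[of 7 6] F[of 14 8] F[of 7 9]
      F[of 25 10] F[of 25 12] F[of 25 14] F[of 7 16] F[of 14 16] F[of 25 17] F[of 25 18]
      F[of 7 20] F[of 25 24] F[of 7 25] lo[of 11] lo[of 13] lo[of 15] lo[of 19] lo[of 21]
      lo[of 22] lo[of 26] lo[of 27] lo[of 28] lo[of 29] lo[of 31]
    show ?thesis
      by (simp add: cube_sum_simps) (use facts[simplified] True in linarith)
  next
    case False
    then have "y 7 = 1"
      using bit_closed_values[OF y, of 7] by blast
    note facts = F[of 7 0] F[of 14 0] F[of 25 0] F[of 25 2] F[of 25 4] F[of 25 5] F[of 14 7] F[of 25 7]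
      cl[of 8 1] cl[of 8 3] cl[of 9 2] cl[of 9 4] cl[of 10 1] cl[of 16 6] F[of 7 16] F[of 14 16]
      F[of 7 17] cl[of 18 8] cl[of 18 17] cl[of 20 1] F[of 25 20] cl[of 24 12] F[of 14 24]
      F[of 25 26] hi[of 18] lo[of 10]
    show ?thesis
      by (simp add: cube_sum_simps) (use facts[simplified] \<open>y 7 = 1\<close> in linarith)
  qed
qed

text \<open>The generators are abc, abd and abe: the kernel elements a, b get weight 3 and the
  petals weight 2.\<close>

lemma fc_weighting_sunflower: "fc_weighting 5 {7, 11, 19} [3, 3, 2, 2, 2] 6"
proof (rule fc_weightingI)
  fix y assume y: "bit_closed y {7, 11, 19}"
  note cl = bit_closed_or[OF y] and F = bit_closed_gen[OF y]
    and lo = bit_closed_nonneg[OF y] and hi = bit_closed_le_1[OF y]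
  show "0 \<le> (\<Sum>n<2 ^ 5. y n * ((\<Sum>i<5. [3, 3, 2, 2, 2] ! i * of_bool (bit n i)) - 6))"
  proof (cases "y 7 = 0")
    case True
    note facts = F[of 7 0] F[of 7 1] F[of 7 2] F[of 7 4] F[of 7 5] F[of 7 6] F[of 11 7] F[of 19 8] F[of 11 9]
      F[of 11 10] F[of 19 12] F[of 19 16] F[of 7 16] F[of 19 17] F[of 7 18] F[of 11 20] F[of 7 24]
      lo[of 13] lo[of 14] lo[of 21] lo[of 22] lo[of 25] lo[of 26] lo[of 29] lo[of 30]
    show ?thesis
      by (simp add: cube_sum_simps) (use facts[simplified] True in linarith)
  next
    case False
    then have "y 7 = 1"
      using bit_closed_values[OF y, of 7] by blast
    note facts = F[of 11 0] F[of 19 0] F[of 19 2] F[of 11 7] F[of 19 7] cl[of 8 1] F[of 19 8] cl[of 9 4]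
      cl[of 12 2] cl[of 12 6] cl[of 16 4] cl[of 16 5] cl[of 16 9] cl[of 16 10] F[of 19 16]
      cl[of 17 12] cl[of 18 4] F[of 11 19] cl[of 20 2] cl[of 20 9] cl[of 22 8] F[of 11 23]
      cl[of 24 2] cl[of 26 4] cl[of 26 6] lo[of 30]
    show ?thesis
      by (simp add: cube_sum_simps) (use facts[simplified] \<open>y 7 = 1\<close> in linarith)
  qed
qed

text \<open>Elements of the \<open>k\<close>-set get weight \<open>\<alpha>\<close>; \<open>c\<close> is the contribution from outside the \<open>k\<close>-set.\<close>

definition cube_sum :: "nat \<Rightarrow> int \<Rightarrow> int \<Rightarrow> (nat \<Rightarrow> int) \<Rightarrow> int" where
  "cube_sum k \<alpha> c y = (\<Sum>n<2 ^ k. y n * (\<alpha> * (2 * (\<Sum>i<k. of_bool (bit n i)) - int k) + c))"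

section \<open>Lower bounds on the 3-cube and the 4-cube\<close>

lemma cube_sum_mono:
  assumes "\<And>n. 0 \<le> y n" "c \<le> d"
  shows "cube_sum k \<alpha> c y \<le> cube_sum k \<alpha> d y"
  unfolding cube_sum_def using assms by (intro sum_mono mult_left_mono) auto

text \<open>The full set is present because F lies in the ambient family. In use \<open>c\<close> is
  2|L| - |Y| for a trace L in Y with |Y| \<le> 6: the constants -4, -2, 0, 2 are 2|L| - 6 for |L| =
  1, 2, 3, 4, while 5 and 6 serve L = Y. The vanishing hypotheses say which sets are too small to
  occur.\<close>

lemma cube_sum_3:
  assumes y: "bit_closed y {}" and top: "y 7 = 1"
  shows cube_sum_3_all: "-5 \<le> cube_sum 3 5 0 y" "0 \<le> cube_sum 3 5 2 y"
      "10 \<le> cube_sum 3 5 5 y" "12 \<le> cube_sum 3 5 6 y"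
    and cube_sum_3_nonempty: "y 0 = 0 \<Longrightarrow> 0 \<le> cube_sum 3 5 (-2) y"
    and cube_sum_3_pairs: "y 0 = 0 \<Longrightarrow> y 1 = 0 \<Longrightarrow> y 2 = 0 \<Longrightarrow> y 4 = 0 \<Longrightarrow> 0 \<le> cube_sum 3 5 (-4) y"
    and cube_sum_3_empty: "y 0 = 1 \<Longrightarrow> (\<And>n. n \<in> {1, 2, 3, 4, 5, 6} \<Longrightarrow> y n = 0) \<Longrightarrow> cube_sum 3 5 c y = 2 * c"
proof -
  have v: "y n = 0 \<or> y n = 1" and nn: "0 \<le> y n" "y n \<le> 1" for n
    using bit_closed_values[OF y] bit_closed_nonneg[OF y] bit_closed_le_1[OF y] by blast+
  note cl = bit_closed_or[OF y, of 1 2] bit_closed_or[OF y, of 1 4] bit_closed_or[OF y, of 2 4]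
  \<comment> \<open>Two singletons force their union, and three singletons force all three
    pairs.\<close>
  have "y (Suc 0) + y 2 + y 4 \<le> 1 + (y 3 + y 5 + y 6)"
    using v[of "Suc 0"] v[of 2] v[of 4] nn(1)[of 3] nn(1)[of 5] nn(1)[of 6] cl[simplified] by auto
  note facts = this nn[of 0] nn(1)[of 3] nn(1)[of 5] nn(1)[of 6] nn(1)[of 1] nn(1)[of 2] nn(1)[of 4]
  note facts = facts[simplified]
  show "-5 \<le> cube_sum 3 5 0 y" "0 \<le> cube_sum 3 5 2 y"
      "10 \<le> cube_sum 3 5 5 y" "12 \<le> cube_sum 3 5 6 y"
    by (simp_all add: cube_sum_def cube_sum_simps top) (use facts in linarith)+
  show "y 0 = 0 \<Longrightarrow> 0 \<le> cube_sum 3 5 (-2) y"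
    by (simp add: cube_sum_def cube_sum_simps top)
      (use cl[simplified] nn(2)[of "Suc 0"] nn(2)[of 2] nn(2)[of 4] in linarith)
  show "y 0 = 0 \<Longrightarrow> y 1 = 0 \<Longrightarrow> y 2 = 0 \<Longrightarrow> y 4 = 0 \<Longrightarrow> 0 \<le> cube_sum 3 5 (-4) y"
    by (simp add: cube_sum_def cube_sum_simps top) (use facts in linarith)
  show "y 0 = 1 \<Longrightarrow> (\<And>n. n \<in> {1, 2, 3, 4, 5, 6} \<Longrightarrow> y n = 0) \<Longrightarrow> cube_sum 3 5 c y = 2 * c"
    by (simp add: cube_sum_def cube_sum_simps top)
qed

text \<open>The analogue for |F| = 4 and |Y| \<le> 5: the constants -3, -1, 1, 3 are 2|L| - 5 for
  |L| = 1, 2, 3, 4.\<close>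

lemma cube_sum_4:
  assumes y: "bit_closed y {}" and top: "y 15 = 1"
  shows cube_sum_4_all: "0 \<le> cube_sum 4 3 3 y"
    and cube_sum_4_nonempty: "y 0 = 0 \<Longrightarrow> 0 \<le> cube_sum 4 3 1 y"
    and cube_sum_4_pairs: "y 0 = 0 \<Longrightarrow> y 1 = 0 \<Longrightarrow> y 2 = 0 \<Longrightarrow> y 4 = 0 \<Longrightarrow> y 8 = 0 \<Longrightarrow> 0 \<le> cube_sum 4 3 (-1) y"
    and cube_sum_4_triples: "y 0 = 0 \<Longrightarrow> (\<And>n. n \<in> {1, 2, 3, 4, 5, 6, 8, 9, 10, 12} \<Longrightarrow> y n = 0)
      \<Longrightarrow> 0 \<le> cube_sum 4 3 (-3) y"
    and cube_sum_4_empty: "y 0 = 1 \<Longrightarrow> (\<And>n. n \<in> {1, 2, 3, 4, 5, 6, 7, 8, 9, 10, 11, 12, 13, 14} \<Longrightarrow> y n = 0) \<Longrightarrow> cube_sum 4 3 c y = 2 * c"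
proof -
  note pairs = bit_closed_or[OF y, of 1 2] bit_closed_or[OF y, of 1 4] bit_closed_or[OF y, of 1 8]
    bit_closed_or[OF y, of 2 4] bit_closed_or[OF y, of 2 8] bit_closed_or[OF y, of 4 8]
  note triples = bit_closed_or[OF y, of 3 4] bit_closed_or[OF y, of 3 8] bit_closed_or[OF y, of 5 8]
    bit_closed_or[OF y, of 6 8]
  have v: "y n = 0 \<or> y n = 1" and nn: "0 \<le> y n" "y n \<le> 1" for n
    using bit_closed_values[OF y] bit_closed_nonneg[OF y] bit_closed_le_1[OF y] by blast+
  note v = v[of "Suc 0"] v[of 2] v[of 4] v[of 8]
  note lo = nn(1)[of 3] nn(1)[of 5] nn(1)[of 6] nn(1)[of 9] nn(1)[of 10] nn(1)[of 12]
    nn(1)[of 7] nn(1)[of 11] nn(1)[of 13] nn(1)[of 14]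
  note hi = nn(2)[of 3] nn(2)[of 5] nn(2)[of 6] nn(2)[of 9] nn(2)[of 10] nn(2)[of 12]
  \<comment> \<open>If j singletons are present, so are all pairs and triples formed from them;
    \<open>p\<close> compares j with the number of pairs, \<open>t\<close> with the number of
    triples.\<close>
  have p: "y (Suc 0) + y 2 + y 4 + y 8 \<le> 1 + (y 3 + y 5 + y 6 + y 9 + y 10 + y 12)"
    using v lo pairs[simplified] by auto
  have t: "y (Suc 0) + y 2 + y 4 + y 8 \<le> 2 + (y 7 + y 11 + y 13 + y 14)"
    using v lo pairs[simplified] triples[simplified] by auto
  show "0 \<le> cube_sum 4 3 3 y"
    by (simp add: cube_sum_def cube_sum_simps top) (use p lo nn[of 0] in linarith)
  show "y 0 = 0 \<Longrightarrow> 0 \<le> cube_sum 4 3 1 y"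
    by (simp add: cube_sum_def cube_sum_simps top) (use t lo v in linarith)
  show "y 0 = 0 \<Longrightarrow> y 1 = 0 \<Longrightarrow> y 2 = 0 \<Longrightarrow> y 4 = 0 \<Longrightarrow> y 8 = 0 \<Longrightarrow> 0 \<le> cube_sum 4 3 (-1) y"
    by (simp add: cube_sum_def cube_sum_simps top) (use hi lo in linarith)
  show "y 0 = 0 \<Longrightarrow> (\<And>n. n \<in> {1, 2, 3, 4, 5, 6, 8, 9, 10, 12} \<Longrightarrow> y n = 0)
      \<Longrightarrow> 0 \<le> cube_sum 4 3 (-3) y"
    by (simp add: cube_sum_def cube_sum_simps top) (use lo in linarith)
  show "y 0 = 1 \<Longrightarrow> (\<And>n. n \<in> {1, 2, 3, 4, 5, 6, 7, 8, 9, 10, 11, 12, 13, 14} \<Longrightarrow> y n = 0) \<Longrightarrow> cube_sum 4 3 c y = 2 * c"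
    by (simp add: cube_sum_def cube_sum_simps top)
qed

section \<open>Splitting a family into cubes\<close>

definition excess :: "'a set set \<Rightarrow> 'a \<Rightarrow> int" where
  "excess \<A> x = 2 * int (card {A \<in> \<A>. x \<in> A}) - int (card \<A>)"

lemma excess_eq_sum:
  assumes "finite \<A>"
  shows "excess \<A> x = (\<Sum>A\<in>\<A>. 2 * of_bool (x \<in> A) - 1)"
proof -
  have "(\<Sum>A\<in>\<A>. of_bool (x \<in> A)) = int (card {A \<in> \<A>. x \<in> A})"
    using assms by (simp add: of_bool_def sum.If_cases Int_def)
  moreover have "(\<Sum>A\<in>\<A>. 2 * of_bool (x \<in> A) - 1) = 2 * (\<Sum>A\<in>\<A>. of_bool (x \<in> A)) - int (card \<A>)"
    by (simp add: sum_subtractf sum_distrib_left)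
  ultimately show ?thesis
    by (simp add: excess_def)
qed

lemma sum_excess:
  assumes "finite \<A>"
  shows "(\<Sum>i\<in>I. w i * excess \<A> (e i)) = (\<Sum>A\<in>\<A>. \<Sum>i\<in>I. w i * (2 * of_bool (e i \<in> A) - 1))"
  unfolding excess_eq_sum[OF assms] sum_distrib_left by (rule sum.swap)

text \<open>Bits from position \<open>k\<close> on are ignored, so every mask is meaningful and
  \<open>sel_or\<close> needs no bound, matching the unbounded quantifiers in
  \<open>bit_closed\<close>.\<close>

definition sel :: "(nat \<Rightarrow> 'a) \<Rightarrow> nat \<Rightarrow> nat \<Rightarrow> 'a set" where
  "sel e k n = e ` {i. i < k \<and> bit n i}"

lemma sel_subset: "sel e k n \<subseteq> e ` {..<k}"
  by (auto simp: sel_def)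

lemma sel_or: "sel e k (or m n) = sel e k m \<union> sel e k n"
  by (auto simp: sel_def bit_or_iff)

lemma sel_0 [simp]: "sel e k 0 = {}"
  by (simp add: sel_def)

lemma sel_mask: "sel e k (2 ^ k - 1) = e ` {..<k}"
proof -
  have "bit (2 ^ k - 1 :: nat) i \<longleftrightarrow> i < k" for i
    using bit_mask_iff[where 'a = nat, of k i] by (simp add: mask_eq_exp_minus_1)
  then show ?thesis
    by (auto simp: sel_def)
qed

lemma mem_sel_iff: "inj_on e {..<k} \<Longrightarrow> i < k \<Longrightarrow> e i \<in> sel e k n \<longleftrightarrow> bit n i"
  by (auto simp: sel_def inj_on_def)

lemma card_sel:
  assumes "inj_on e {..<k}"
  shows "int (card (sel e k n)) = (\<Sum>i<k. of_bool (bit n i))"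
proof -
  have "card (sel e k n) = card {i. i < k \<and> bit n i}"
    unfolding sel_def by (rule card_image) (use assms in \<open>auto simp: inj_on_def\<close>)
  also have "{i. i < k \<and> bit n i} = {..<k} \<inter> {i. bit n i}"
    by auto
  finally show ?thesis
    by (simp add: of_bool_def sum.If_cases)
qed

lemma bij_betw_sel:
  assumes "inj_on e {..<k}"
  shows "bij_betw (sel e k) {..<2 ^ k} (Pow (e ` {..<k}))"
proof -
  have inj: "inj_on (sel e k) {..<2 ^ k}"
  proof (rule inj_onI)
    fix m n :: nat
    assume "m \<in> {..<2 ^ k}" "n \<in> {..<2 ^ k}" and eq: "sel e k m = sel e k n"
    then have "take_bit k m = m" "take_bit k n = n"
      by (simp_all add: take_bit_nat_eq_self)
    moreover have "take_bit k m = take_bit k n"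
    proof (rule bit_eqI)
      fix i
      show "bit (take_bit k m) i = bit (take_bit k n) i"
      proof (cases "i < k")
        case True
        then show ?thesis
          using mem_sel_iff[OF assms, of i m] mem_sel_iff[OF assms, of i n] eq
          by (simp add: bit_take_bit_iff)
      qed (simp add: bit_take_bit_iff)
    qed
    ultimately show "m = n"
      by metis
  qed
  moreover have "sel e k ` {..<2 ^ k} = Pow (e ` {..<k})"
  proof (rule card_subset_eq)
    show "card (sel e k ` {..<2 ^ k}) = card (Pow (e ` {..<k}))"
      using card_image[OF inj] card_image[OF assms] by (simp add: card_Pow)
    show "sel e k ` {..<2 ^ k} \<subseteq> Pow (e ` {..<k})"
      by (intro image_subsetI PowI sel_subset)
  qed simp
  ultimately show ?thesis
    by (simp add: bij_betw_def)
qed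

lemma sum_fibres:
  fixes f :: "'a set \<Rightarrow> int"
  assumes fin: "finite \<A>" and inj: "inj_on e {..<k}"
  shows "(\<Sum>A\<in>\<A>. f A)
    = (\<Sum>L\<in>(\<lambda>A. A - e ` {..<k}) ` \<A>. \<Sum>n<2 ^ k. of_bool (sel e k n \<union> L \<in> \<A>) * f (sel e k n \<union> L))"
proof -
  let ?P = "e ` {..<k}"
  have "(\<Sum>A\<in>{A \<in> \<A>. A - ?P = L}. f A) = (\<Sum>n<2 ^ k. of_bool (sel e k n \<union> L \<in> \<A>) * f (sel e k n \<union> L))"
    if "L \<in> (\<lambda>A. A - ?P) ` \<A>" for L
  proof -
    have disj: "L \<inter> ?P = {}"
      using that by auto
    have "(\<Sum>n<2 ^ k. of_bool (sel e k n \<union> L \<in> \<A>) * f (sel e k n \<union> L))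
        = (\<Sum>B\<in>Pow ?P. of_bool (B \<union> L \<in> \<A>) * f (B \<union> L))"
      by (rule sum.reindex_bij_betw[OF bij_betw_sel[OF inj]])
    also have "\<dots> = (\<Sum>B\<in>{B \<in> Pow ?P. B \<union> L \<in> \<A>}. f (B \<union> L))"
      by (rule sum.mono_neutral_cong_right) auto
    also have "\<dots> = (\<Sum>A\<in>{A \<in> \<A>. A - ?P = L}. f A)"
    proof (rule sum.reindex_bij_witness[where i = "\<lambda>A. A \<inter> ?P" and j = "\<lambda>B. B \<union> L"])
      fix A assume A: "A \<in> {A \<in> \<A>. A - ?P = L}"
      then show eq: "A \<inter> ?P \<union> L = A"
        by blast
      show "A \<inter> ?P \<in> {B \<in> Pow ?P. B \<union> L \<in> \<A>}"
        using A unfolding mem_Collect_eq eq by blast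
    next
      fix B assume "B \<in> {B \<in> Pow ?P. B \<union> L \<in> \<A>}"
      then show "(B \<union> L) \<inter> ?P = B" "B \<union> L \<in> {A \<in> \<A>. A - ?P = L}"
        using disj by blast+
    qed simp
    finally show ?thesis ..
  qed
  then show ?thesis
    by (intro trans[OF sum.image_gen[OF fin, of f "\<lambda>A. A - ?P"]] sum.cong) auto
qed

text \<open>The ten 3-subsets are grouped by their position relative to abc and ade: these two
  themselves, a with one point from each pair, and those avoiding a.\<close>

lemma triple_in_five:
  assumes "C \<subseteq> {a, b, c, d, e}" "card C = 3" "distinct [a, b, c, d, e]"
  shows "C \<in> {{a, b, c}, {a, d, e}} \<union> {{a, b, d}, {a, b, e}, {a, c, d}, {a, c, e}}
    \<union> {{b, c, d}, {b, c, e}, {b, d, e}, {c, d, e}}"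
proof -
  have "C \<in> Pow {a, b, c, d, e}"
    using assms(1) by simp
  then show ?thesis
    using assms(2,3) by (simp add: Pow_insert image_insert) (elim disjE; simp)
qed

section \<open>Counterexamples\<close>

text \<open>The ground set is the union of the family, so every ground element occurs in some
  member. Having \<open>{}\<close> as a member is harmless, since adding it only makes elements
  rarer.\<close>

locale counterexample =
  fixes \<A> :: "'a set set"
  assumes finite_ground: "finite (\<Union>\<A>)" and empty_mem: "{} \<in> \<A>" and closed: "union_closed \<A>"
    and rare: "x \<in> \<Union>\<A> \<Longrightarrow> excess \<A> x < 0"
begin

section \<open>Weighted counting over fibres\<close>

lemma Un_mem: "A \<in> \<A> \<Longrightarrow> B \<in> \<A> \<Longrightarrow> A \<union> B \<in> \<A>"
  using closed by (auto simp: union_closed_def)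

lemma finite_family: "finite \<A>"
  using finite_ground by (rule finite_UnionD)

lemma finite_mem: "A \<in> \<A> \<Longrightarrow> finite A"
  using finite_ground by (meson Union_upper finite_subset)

text \<open>A negative integer excess is at most -1, which gains the full total weight over the
  bound 0.\<close>

lemma weighted_sum_le:
  fixes w :: "'b \<Rightarrow> int"
  assumes "\<And>i. i \<in> I \<Longrightarrow> 0 \<le> w i" and "\<And>i. i \<in> I \<Longrightarrow> e i \<in> \<Union>\<A>"
  shows "(\<Sum>A\<in>\<A>. \<Sum>i\<in>I. w i * (2 * of_bool (e i \<in> A) - 1)) \<le> - (\<Sum>i\<in>I. w i)"
proof -
  have "(\<Sum>i\<in>I. w i * excess \<A> (e i)) \<le> (\<Sum>i\<in>I. - w i)"
  proof (rule sum_mono)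
    fix i assume "i \<in> I"
    then have "excess \<A> (e i) \<le> - 1" "0 \<le> w i"
      using rare[of "e i"] assms by auto
    then show "w i * excess \<A> (e i) \<le> - w i"
      using mult_left_mono[of "excess \<A> (e i)" "- 1" "w i"] by simp
  qed
  then show ?thesis
    by (simp only: sum_excess[OF finite_family] sum_negf)
qed

text \<open>Uniting two members over the same L stays over L, and a generator lies inside the cube,
  so it does not change L either.\<close>

lemma bit_closed_fibre:
  assumes "\<And>f. f \<in> G \<Longrightarrow> sel e k f \<in> \<A>"
  shows "bit_closed (\<lambda>n. of_bool (sel e k n \<union> L \<in> \<A>)) G"
proof -
  have "sel e k (or m n) \<union> L \<in> \<A>" if "sel e k m \<union> L \<in> \<A>" "sel e k n \<union> L \<in> \<A>" for m n
    using Un_mem[OF that] by (simp add: sel_or Un_ac)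
  moreover have "sel e k (or n f) \<union> L \<in> \<A>" if "f \<in> G" "sel e k n \<union> L \<in> \<A>" for n f
    using Un_mem[OF that(2) assms[OF that(1)]] by (simp add: sel_or Un_ac)
  ultimately show ?thesis
    by (auto simp: bit_closed_def)
qed

text \<open>This is the use of Poonen's criterion: every fibre contributes a nonnegative amount,
  whereas rarity makes the total at most -2c < 0.\<close>

lemma no_fc_weighting:
  assumes fc: "fc_weighting k G w c" and inj: "inj_on e {..<k}" and sub: "e ` {..<k} \<subseteq> \<Union>\<A>"
    and gen: "\<And>f. f \<in> G \<Longrightarrow> sel e k f \<in> \<A>"
    and w: "\<And>i. i < k \<Longrightarrow> 0 \<le> w ! i" "(\<Sum>i<k. w ! i) = 2 * c" "0 < c"
  shows False
proof -
  \<comment> \<open>Since L misses the cube, membership of \<open>e i\<close> depends on the bit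
    alone; the factor 2 comes from replacing the signs \<plusminus>1 by indicators.\<close>
  have inner: "(\<Sum>i<k. w ! i * (2 * of_bool (e i \<in> sel e k n \<union> L) - 1))
      = 2 * ((\<Sum>i<k. w ! i * of_bool (bit n i)) - c)" if "L \<in> (\<lambda>A. A - e ` {..<k}) ` \<A>" for n L
  proof -
    have "(\<Sum>i<k. w ! i * (2 * of_bool (e i \<in> sel e k n \<union> L) - 1))
        = (\<Sum>i<k. 2 * (w ! i * of_bool (bit n i)) - w ! i)"
      by (rule sum.cong) (use that mem_sel_iff[OF inj] in \<open>auto simp: algebra_simps\<close>)
    then show ?thesis
      by (simp add: sum_subtractf w(2) right_diff_distrib flip: sum_distrib_left)
  qed
  have "(\<Sum>A\<in>\<A>. \<Sum>i<k. w ! i * (2 * of_bool (e i \<in> A) - 1))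
      = (\<Sum>L\<in>(\<lambda>A. A - e ` {..<k}) ` \<A>. 2 * (\<Sum>n<2 ^ k. of_bool (sel e k n \<union> L \<in> \<A>)
          * ((\<Sum>i<k. w ! i * of_bool (bit n i)) - c)))"
    unfolding sum_fibres[OF finite_family inj] sum_distrib_left[of 2 _ "{..<2 ^ k}"]
    by (intro sum.cong refl) (simp only: inner mult.left_commute)
  also have "\<dots> \<ge> 0"
    using fc[unfolded fc_weighting_def, rule_format, OF bit_closed_fibre[OF gen]]
    by (intro sum_nonneg) simp
  moreover have "(\<Sum>A\<in>\<A>. \<Sum>i<k. w ! i * (2 * of_bool (e i \<in> A) - 1)) \<le> - (\<Sum>i<k. w ! i)"
    by (rule weighted_sum_le) (use w sub in auto)
  ultimately show False
    using w by simp
qed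

text \<open>Take weight \<alpha> on F and 1 elsewhere. Over a fixed L the elements outside F
  contribute the constant 2|L| - |Y| to each member, where Y is the complement of F, so each fibre
  yields one \<open>cube_sum\<close>.\<close>

lemma cube_sum_le:
  assumes inj: "inj_on e {..<k}" and F: "F = e ` {..<k}" and sub: "F \<subseteq> \<Union>\<A>" and "0 \<le> \<alpha>"
  shows "(\<Sum>L\<in>(\<lambda>A. A - F) ` \<A>. cube_sum k \<alpha> (2 * int (card L) - int (card (\<Union>\<A> - F)))
      (\<lambda>n. of_bool (sel e k n \<union> L \<in> \<A>))) \<le> - (\<alpha> * int k + int (card (\<Union>\<A> - F)))"
proof -
  define w where "w x = (if x \<in> F then \<alpha> else 1)" for x
  define g where "g A = \<alpha> * (2 * int (card (A \<inter> F)) - int k) + (2 * int (card (A - F)) - int (card (\<Union>\<A> - F)))" for A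
  have finF: "finite F" and cardF: "card F = k"
    using F card_image[OF inj] by auto
  have split: "(\<Sum>x\<in>\<Union>\<A>. h x) = (\<Sum>x\<in>F. h x) + (\<Sum>x\<in>\<Union>\<A> - F. h x)" for h :: "'a \<Rightarrow> int"
    using sum.subset_diff[OF sub finite_ground, of h] by simp
  have count: "(\<Sum>x\<in>X. of_bool (x \<in> A)) = int (card (A \<inter> X))" if "finite X" for X A :: "'a set"
    using that by (simp add: of_bool_def sum.If_cases Int_def conj_commute)
  have "(\<Sum>x\<in>\<Union>\<A>. w x * (2 * of_bool (x \<in> A) - 1)) = g A" if "A \<in> \<A>" for A
  proof -
    have "(\<Sum>x\<in>F. w x * (2 * of_bool (x \<in> A) - 1)) = \<alpha> * (2 * int (card (A \<inter> F)) - int k)"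
      using finF by (simp add: w_def sum_subtractf count cardF Int_commute flip: sum_distrib_left)
    moreover have "(\<Sum>x\<in>\<Union>\<A> - F. w x * (2 * of_bool (x \<in> A) - 1)) = 2 * int (card (A \<inter> (\<Union>\<A> - F))) - int (card (\<Union>\<A> - F))"
      using finite_ground by (simp add: w_def sum_subtractf count Int_commute flip: sum_distrib_left)
    moreover have "A \<inter> (\<Union>\<A> - F) = A - F"
      using that by blast
    ultimately show ?thesis
      by (simp add: split g_def)
  qed
  moreover have "(\<Sum>x\<in>\<Union>\<A>. w x) = \<alpha> * int k + int (card (\<Union>\<A> - F))"
    by (simp add: split w_def cardF)
  moreover have "(\<Sum>A\<in>\<A>. \<Sum>x\<in>\<Union>\<A>. w x * (2 * of_bool (x \<in> A) - 1)) \<le> - (\<Sum>x\<in>\<Union>\<A>. w x)"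
    using \<open>0 \<le> \<alpha>\<close> by (intro weighted_sum_le) (auto simp: w_def)
  ultimately have "(\<Sum>A\<in>\<A>. g A) \<le> - (\<alpha> * int k + int (card (\<Union>\<A> - F)))"
    by simp
  moreover have "g (sel e k n \<union> L) = \<alpha> * (2 * (\<Sum>i<k. of_bool (bit n i)) - int k)
      + (2 * int (card L) - int (card (\<Union>\<A> - F)))" if "L \<in> (\<lambda>A. A - F) ` \<A>" for n L
  proof -
    have "(sel e k n \<union> L) \<inter> F = sel e k n" "(sel e k n \<union> L) - F = L"
      using that sel_subset[of e k n] F by blast+
    then show ?thesis
      by (simp add: g_def card_sel[OF inj])
  qed
  ultimately show ?thesis
    unfolding sum_fibres[OF finite_family inj] F[symmetric] cube_sum_def by simp
qed

text \<open>If L = A - F, then F \<union> L = F \<union> A. Hence F is present in every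
  fibre.\<close>

lemma fibre_top:
  assumes "sel e k n = F" "F \<in> \<A>" "L \<in> (\<lambda>A. A - F) ` \<A>"
  shows "sel e k n \<union> L \<in> \<A>"
  using assms Un_mem by (auto simp: Un_Diff_cancel)

text \<open>The traces are disjoint, so their sizes add up to that of the member; \<open>pos\<close>
  sets aside the empty member. This supplies the vanishing hypotheses of the cube bounds.\<close>

lemma fibre_small:
  assumes inj: "inj_on e {..<k}" and min: "\<And>A. A \<in> \<A> \<Longrightarrow> A \<noteq> {} \<Longrightarrow> m \<le> card A"
    and L: "L \<in> (\<lambda>A. A - e ` {..<k}) ` \<A>"
    and pos: "0 < (\<Sum>i<k. of_bool (bit n i)) + int (card L)"
    and small: "(\<Sum>i<k. of_bool (bit n i)) + int (card L) < int m"
  shows "sel e k n \<union> L \<notin> \<A>"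
proof
  assume mem: "sel e k n \<union> L \<in> \<A>"
  have "finite L" "finite (sel e k n)"
    using finite_mem[OF mem] by simp_all
  moreover have "sel e k n \<inter> L = {}"
    using L sel_subset[of e k n] by blast
  ultimately have "int (card (sel e k n \<union> L)) = (\<Sum>i<k. of_bool (bit n i)) + int (card L)"
    by (simp add: card_Un_disjoint card_sel[OF inj])
  then show False
    using min[OF mem] pos small by fastforce
qed

section \<open>Forbidden configurations of small members\<close>

lemma sel_nth_simps:
  "sel e 0 n = {}"
  "sel e (Suc k) n = (if bit n k then insert (e k) (sel e k n) else sel e k n)"
  "sel e (numeral v) n = (if bit n (pred_numeral v) then insert (e (pred_numeral v)) (sel e (pred_numeral v) n)
    else sel e (pred_numeral v) n)"
  by (auto simp: sel_def less_Suc_eq numeral_eq_Suc)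

text \<open>Enumerating the cube by a list lets simplification turn masks into explicit sets. The
  generators cover the list, so its entries lie in the ground set.\<close>

lemma no_fc_list:
  assumes fc: "fc_weighting k G w c" and k: "length xs = k" "length w = k"
    and "distinct xs" and "set xs \<subseteq> (\<Union>f\<in>G. sel ((!) xs) k f)"
    and "\<forall>f\<in>G. sel ((!) xs) k f \<in> \<A>"
    and "\<forall>x\<in>set w. 0 \<le> x" "sum_list w = 2 * c" "0 < c"
  shows False
proof (rule no_fc_weighting[OF fc])
  show "inj_on ((!) xs) {..<k}"
    using assms by (auto intro: inj_on_nth)
  show "(!) xs ` {..<k} \<subseteq> \<Union>\<A>"
  proof -
    have "(!) xs ` {..<k} = set xs"
      using k by (auto simp: set_conv_nth)
    also have "\<dots> \<subseteq> (\<Union>f\<in>G. sel ((!) xs) k f)"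
      by (rule assms)
    also have "\<dots> \<subseteq> \<Union>\<A>"
      using assms(6) by blast
    finally show ?thesis .
  qed
  show "(\<Sum>i<k. w ! i) = 2 * c"
    using assms by (simp add: sum_list_sum_nth atLeast0LessThan)
qed (use assms in auto)

lemma no_singleton: "{a} \<notin> \<A>"
  using no_fc_list[OF fc_weighting_singleton, of "[a]"]
  by (auto simp: sel_nth_simps bit_Suc_0_iff)

lemma no_pair: "a \<noteq> b \<Longrightarrow> {a, b} \<notin> \<A>"
  using no_fc_list[OF fc_weighting_pair, of "[a, b]"]
  by (auto simp: sel_nth_simps bit_Suc_0_iff insert_commute)

lemma no_star:
  assumes "distinct [a, b, c, d]" "{a, b, c} \<in> \<A>" "{a, b, d} \<in> \<A>" "{a, c, d} \<in> \<A>"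
  shows False
  by (rule no_fc_list[OF fc_weighting_star, of "[a, b, c, d]"])
    (use assms in \<open>auto simp: sel_nth_simps bit_Suc_0_iff insert_commute\<close>)

lemma no_sunflower:
  assumes "distinct [a, b, c, d, e]" "{a, b, c} \<in> \<A>" "{a, b, d} \<in> \<A>" "{a, b, e} \<in> \<A>"
  shows False
  by (rule no_fc_list[OF fc_weighting_sunflower, of "[a, b, c, d, e]"])
    (use assms in \<open>auto simp: sel_nth_simps bit_Suc_0_iff insert_commute\<close>)

lemma no_path:
  assumes "distinct [a, b, c, d, e]" "{a, b, c} \<in> \<A>" "{a, d, e} \<in> \<A>" "{a, b, d} \<in> \<A>"
  shows False
  by (rule no_fc_list[OF fc_weighting_path, of "[a, b, c, d, e]"])
    (use assms in \<open>auto simp: sel_nth_simps bit_Suc_0_iff insert_commute\<close>)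

lemma no_split:
  assumes "distinct [a, b, c, d, e]" "{a, b, c} \<in> \<A>" "{a, d, e} \<in> \<A>" "{b, c, d} \<in> \<A>"
  shows False
  by (rule no_fc_list[OF fc_weighting_split, of "[a, b, c, d, e]"])
    (use assms in \<open>auto simp: sel_nth_simps bit_Suc_0_iff insert_commute\<close>)

text \<open>Here A \<union> B already has five points, so C lies inside it. Swapping b with c, d
  with e, or A with B reduces C to abd (\<open>no_path\<close>) if it contains the common point, and
  to bcd (\<open>no_split\<close>) otherwise.\<close>

lemma no_triples_meeting_once:
  assumes mem: "A \<in> \<A>" "B \<in> \<A>" "C \<in> \<A>" and card: "card A = 3" "card B = 3" "card C = 3"
    and neq: "A \<noteq> C" "B \<noteq> C" and five: "card (A \<union> B \<union> C) \<le> 5" and once: "card (A \<inter> B) = 1"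
  shows False
proof -
  have fin: "finite A" "finite B" "finite C"
    using card by (auto intro: card_ge_0_finite)
  obtain a where a: "A \<inter> B = {a}"
    using once by (auto simp: card_1_singleton_iff)
  then have "card (A - {a}) = 2" "card (B - {a}) = 2"
    using card fin by (auto simp: card_Diff_singleton_if)
  then obtain b c d e where bc: "A - {a} = {b, c}" "b \<noteq> c" and de: "B - {a} = {d, e}" "d \<noteq> e"
    by (auto simp: card_2_iff)
  then have A: "A = {a, b, c}" and B: "B = {a, d, e}"
    using a by blast+
  have dist: "distinct [a, b, c, d, e]"
    using a bc de by auto
  have "{a, b, c, d, e} = A \<union> B \<union> C"
  proof (rule card_seteq)
    show "card (A \<union> B \<union> C) \<le> card {a, b, c, d, e}"
      using five dist by simp
  qed (use fin A B in auto)
  then have "C \<subseteq> {a, b, c, d, e}"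
    by blast
  then have "C \<in> {{a, b, c}, {a, d, e}} \<union> {{a, b, d}, {a, b, e}, {a, c, d}, {a, c, e}}
      \<union> {{b, c, d}, {b, c, e}, {b, d, e}, {c, d, e}}"
    using card(3) dist by (rule triple_in_five)
  moreover have "C \<noteq> {a, b, c}" "C \<noteq> {a, d, e}"
    using neq A B by simp_all
  ultimately consider "C = {a, b, d}" | "C = {a, b, e}" | "C = {a, c, d}" | "C = {a, c, e}"
    | "C = {b, c, d}" | "C = {b, c, e}" | "C = {b, d, e}" | "C = {c, d, e}"
    unfolding Un_iff insert_iff empty_iff by argo
  then show False
  proof cases
    case 1
    show False
      by (rule no_path[of a b c d e]) (use mem dist in \<open>simp_all add: A B 1\<close>)
  next
    case 2
    show False
      by (rule no_path[of a b c e d]) (use mem dist in \<open>auto simp: A B 2 insert_commute\<close>)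
  next
    case 3
    show False
      by (rule no_path[of a c b d e]) (use mem dist in \<open>auto simp: A B 3 insert_commute\<close>)
  next
    case 4
    show False
      by (rule no_path[of a c b e d]) (use mem dist in \<open>auto simp: A B 4 insert_commute\<close>)
  next
    case 5
    show False
      by (rule no_split[of a b c d e]) (use mem dist in \<open>simp_all add: A B 5\<close>)
  next
    case 6
    show False
      by (rule no_split[of a b c e d]) (use mem dist in \<open>auto simp: A B 6 insert_commute\<close>)
  next
    case 7
    show False
      by (rule no_split[of a d e b c]) (use mem dist in \<open>auto simp: A B 7 insert_commute\<close>)
  next
    case 8
    show False
      by (rule no_split[of a d e c b]) (use mem dist in \<open>auto simp: A B 8 insert_commute\<close>)
  qed
qed

text \<open>Two distinct 3-sets inside five points meet in one or two points. Once single
  intersections are excluded, all pairs meet in two points: either all three sets share a pair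
  (\<open>no_sunflower\<close>) or they lie in a common 4-set (\<open>no_star\<close>).\<close>

lemma no_three_triples:
  assumes mem: "A \<in> \<A>" "B \<in> \<A>" "C \<in> \<A>" and card: "card A = 3" "card B = 3" "card C = 3"
    and neq: "A \<noteq> B" "A \<noteq> C" "B \<noteq> C" and five: "card (A \<union> B \<union> C) \<le> 5"
  shows False
proof -
  have fin: "finite A" "finite B" "finite C"
    using card by (auto intro: card_ge_0_finite)
  have two: "card (X \<inter> Z) = 2"
    if "card X = 3" "card Z = 3" "X \<noteq> Z" "card (X \<union> Z) \<le> 5" "card (X \<inter> Z) \<noteq> 1" for X Z :: "'a set"
  proof -
    have fin: "finite X" "finite Z"
      using that by (auto intro: card_ge_0_finite)
    have "card (X \<inter> Z) \<noteq> 3"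
      using that fin by (metis card_subset_eq inf_le1 inf_le2)
    moreover have "card (X \<inter> Z) \<le> 3"
      using that(1) fin card_mono[of X "X \<inter> Z"] by simp
    ultimately show ?thesis
      using card_Un_Int[OF fin] that by simp
  qed
  have sub: "card (A \<union> B) \<le> 5" "card (A \<union> C) \<le> 5" "card (B \<union> C) \<le> 5"
    using five fin card_mono[of "A \<union> B \<union> C" "A \<union> B"] card_mono[of "A \<union> B \<union> C" "A \<union> C"]
      card_mono[of "A \<union> B \<union> C" "B \<union> C"] by (simp_all add: subset_iff)
  have five': "card (A \<union> C \<union> B) \<le> 5" "card (B \<union> C \<union> A) \<le> 5"
    using five by (simp_all add: Un_ac)
  have AB: "card (A \<inter> B) = 2"
    using two[of A B] no_triples_meeting_once[OF mem card neq(2,3) five] card neq sub by blast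
  have AC: "card (A \<inter> C) = 2"
    using two[of A C] no_triples_meeting_once[of A C B] five' mem card neq sub by blast
  have BC: "card (B \<inter> C) = 2"
    using two[of B C] no_triples_meeting_once[of B C A] five' mem card neq sub by blast
  obtain a b where ab: "A \<inter> B = {a, b}" "a \<noteq> b"
    using AB by (auto simp: card_2_iff)
  have "card (A - {a, b}) = 1" "card (B - {a, b}) = 1"
    using ab card card_Diff_subset[of "{a, b}" A] card_Diff_subset[of "{a, b}" B]
      Int_lower1[of A B] Int_lower2[of A B] by simp_all
  then obtain c d where "A - {a, b} = {c}" "B - {a, b} = {d}"
    by (auto simp: card_1_singleton_iff)
  then have A: "A = {a, b, c}" and B: "B = {a, b, d}" and dist: "distinct [a, b, c, d]"
    using ab neq by auto
  show False
  proof (cases "a \<in> C \<and> b \<in> C")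
    case True
    then have "card (C - {a, b}) = 1"
      using card fin dist card_Diff_subset[of "{a, b}" C] by auto
    then obtain e where "C - {a, b} = {e}"
      by (auto simp: card_1_singleton_iff)
    then have "C = {a, b, e}" "e \<notin> {a, b}"
      using True by auto
    then show False
      using no_sunflower[of a b c d e] mem dist neq unfolding A B by auto
  next
    case False
    have "A \<inter> C \<subseteq> {a, b, c}" "B \<inter> C \<subseteq> {a, b, d}"
      using A B by auto
    \<comment> \<open>C meets abc and abd in two points each, so lacking a or b it must contain c, d
      and the other one of a, b.\<close>
    with False have "c \<in> C" "d \<in> C" "a \<in> C \<or> b \<in> C"
      using AC BC dist unfolding A B by (auto simp: Int_insert_left split: if_splits)
    then have "{a, c, d} \<subseteq> C \<or> {b, c, d} \<subseteq> C"
      by auto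
    then have "C = {a, c, d} \<or> C = {b, c, d}"
      using card fin dist card_subset_eq[of C "{a, c, d}"] card_subset_eq[of C "{b, c, d}"] by auto
    then show False
      using no_star[of a b c d] no_star[of b a c d] mem dist unfolding A B by (auto simp: insert_commute)
  qed
qed

end

text \<open>If |Y| \<le> 5, then Y itself serves. If |Y| = 6, each triple misses three points,
  giving at least 15 incidences; as 15 > 6 * 2, some point is missed by three triples and can be
  deleted.\<close>

lemma three_triples_in_five:
  fixes Y :: "'a set"
  assumes "finite Y" "card Y \<le> 6" and G: "\<And>G. G \<in> \<G> \<Longrightarrow> G \<subseteq> Y \<and> card G = 3"
    and "3 \<le> card \<G>" "card Y = 6 \<Longrightarrow> 5 \<le> card \<G>"
  obtains A B C where "A \<in> \<G>" "B \<in> \<G>" "C \<in> \<G>" "A \<noteq> B" "A \<noteq> C" "B \<noteq> C" "card (A \<union> B \<union> C) \<le> 5"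
proof -
  have fin: "finite \<G>"
    using assms(4) by (auto intro: card_ge_0_finite)
  obtain Z where Z: "finite Z" "card Z \<le> 5" "3 \<le> card {G \<in> \<G>. G \<subseteq> Z}"
  proof (cases "card Y = 6")
    case False
    have "{G \<in> \<G>. G \<subseteq> Y} = \<G>"
      using G by auto
    then show ?thesis
      using that[of Y] False assms by simp
  next
    case True
    have "(\<Sum>z\<in>Y. card {G \<in> \<G>. z \<notin> G}) = (\<Sum>G\<in>\<G>. card {z \<in> Y. z \<notin> G})"
      using \<open>finite Y\<close> fin by (intro sum_multicount_gen[symmetric] ballI) auto
    also have "\<dots> = (\<Sum>G\<in>\<G>. 3)"
    proof (rule sum.cong)
      fix H assume "H \<in> \<G>"
      moreover have "{z \<in> Y. z \<notin> H} = Y - H"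
        by auto
      ultimately show "card {z \<in> Y. z \<notin> H} = 3"
        using G[of H] True \<open>finite Y\<close> card_Diff_subset[of H Y] finite_subset[of H Y] by simp
    qed simp
    finally have "15 \<le> (\<Sum>z\<in>Y. card {G \<in> \<G>. z \<notin> G})"
      using assms(5)[OF True] by simp
    moreover have "(\<Sum>z\<in>Y. card {G \<in> \<G>. z \<notin> G}) \<le> card Y * 2" if "\<forall>z\<in>Y. card {G \<in> \<G>. z \<notin> G} \<le> 2"
      using sum_bounded_above[of Y "\<lambda>z. card {G \<in> \<G>. z \<notin> G}" 2] that by simp
    ultimately obtain z where z: "z \<in> Y" "3 \<le> card {G \<in> \<G>. z \<notin> G}"
      using True by fastforce
    have "{G \<in> \<G>. G \<subseteq> Y - {z}} = {G \<in> \<G>. z \<notin> G}"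
      using G by auto
    then show ?thesis
      using that[of "Y - {z}"] z True \<open>finite Y\<close> by simp
  qed
  obtain T where "T \<subseteq> {G \<in> \<G>. G \<subseteq> Z}" "card T = 3"
    using obtain_subset_with_card_n[OF Z(3)] by metis
  then obtain A B C where "T = {A, B, C}" "A \<noteq> B" "A \<noteq> C" "B \<noteq> C"
    by (auto simp: card_3_iff)
  with \<open>T \<subseteq> _\<close> show ?thesis
    using that[of A B C] Z card_mono[of Z "A \<union> B \<union> C"] by auto
qed

section \<open>Excluding each size of a smallest nonempty member\<close>

context counterexample
begin

lemma Union_mem: "\<Union>\<A> \<in> \<A>"
proof -
  have "finite \<B> \<Longrightarrow> \<B> \<subseteq> \<A> \<Longrightarrow> \<Union>\<B> \<in> \<A>" for \<B>
    by (induction \<B> rule: finite_induct) (auto intro: empty_mem Un_mem)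
  then show ?thesis
    using finite_family by blast
qed

lemma fibre_base_cases:
  assumes "F \<in> \<A>"
  shows "{} \<in> (\<lambda>A. A - F) ` \<A>" "\<Union>\<A> - F \<in> (\<lambda>A. A - F) ` \<A>"
  using assms Union_mem by force+

lemma no_min_3:
  assumes F: "F \<in> \<A>" "card F = 3" and min: "\<And>A. A \<in> \<A> \<Longrightarrow> A \<noteq> {} \<Longrightarrow> 3 \<le> card A"
    and nine: "card (\<Union>\<A>) \<le> 9"
  shows False
proof -
  obtain e where "bij_betw e {0..<3 :: nat} F"
    using ex_bij_betw_nat_finite[OF finite_mem[OF F(1)]] F(2) by auto
  then have inj: "inj_on e {..<3}" and Fe: "F = e ` {..<3}"
    by (auto simp: bij_betw_def atLeast0LessThan)
  define Y where "Y = \<Union>\<A> - F"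
  define y where "y = int (card Y)"
  define \<L> where "\<L> = (\<lambda>A. A - F) ` \<A>"
  \<comment> \<open>Apart from the empty trace, only these traces can have a negative
    contribution.\<close>
  define \<G> where "\<G> = {L \<in> \<L>. card L = 3 \<and> L \<in> \<A>}"
  define Z where "Z L n = (of_bool (sel e 3 n \<union> L \<in> \<A>) :: int)" for L n
  define h where "h L = cube_sum 3 5 (2 * int (card L) - y) (Z L)" for L
  have fin: "finite \<L>" "finite Y"
    using finite_family finite_ground by (auto simp: \<L>_def Y_def)
  have sub: "F \<subseteq> \<Union>\<A>"
    using F by blast
  have y6: "y \<le> 6"
    using nine F(2) finite_mem[OF F(1)] card_Diff_subset[OF _ sub] by (simp add: y_def Y_def)
  have LY: "L \<subseteq> Y" if "L \<in> \<L>" for L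
    using that by (auto simp: \<L>_def Y_def)
  have total: "(\<Sum>L\<in>\<L>. h L) \<le> - (15 + y)"
    using cube_sum_le[OF inj Fe sub, of 5] by (simp add: h_def Z_def[abs_def] \<L>_def y_def Y_def)
  \<comment> \<open>Over the empty trace only \<open>{}\<close> and F survive, contributing -2y.
    Over L = Y the bounds 10 and 12 for y = 5, 6 equal 2y and cancel this; for y = 4 the bound 2y
    could fail. A trace in \<open>\<G>\<close> costs at most 5.\<close>
  have lower: "2 * y * of_bool (L = Y \<and> 5 \<le> y) - 2 * y * of_bool (L = {}) - 5 * of_bool (L \<in> \<G>) \<le> h L"
    if L: "L \<in> \<L>" for L
  proof -
    have closed: "bit_closed (Z L) {}"
      unfolding Z_def by (rule bit_closed_fibre) simp
    have "sel e 3 7 = F"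
      using sel_mask[of e 3] Fe by simp
    then have top: "Z L 7 = 1"
      using fibre_top F(1) L by (simp add: Z_def \<L>_def)
    have small: "Z L n = 0" if "0 < (\<Sum>i<3. of_bool (bit n i)) + int (card L)"
      "(\<Sum>i<3. of_bool (bit n i)) + int (card L) < 3" for n
      using fibre_small[OF inj min, of L n] that L by (simp add: Z_def \<L>_def Fe)
    have mono: "cube_sum 3 5 c (Z L) \<le> h L" if "c \<le> 2 * int (card L) - y" for c
      unfolding h_def by (rule cube_sum_mono) (use that in \<open>auto simp: Z_def\<close>)
    have Z0: "Z L 0 = of_bool (L \<in> \<A>)"
      by (simp add: Z_def)
    consider "L = {}" | "card L = 1" | "card L = 2" | "card L = 3" | "4 \<le> card L"
      using finite_subset[OF LY[OF L] fin(2)] by (cases "card L = 0") fastforce+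
    then show ?thesis
    proof cases
      case 1
      have "Z L n = 0" if "n \<in> {1, 2, 3, 4, 5, 6}" for n
        using that by (intro small) (auto simp: 1 cube_sum_simps)
      then have "h L = 2 * - y"
        unfolding h_def using cube_sum_3_empty[OF closed top, of "- y"] Z0 empty_mem 1 by simp
      then show ?thesis
        using 1 by (auto simp: \<G>_def y_def)
    next
      case 2
      have "0 \<le> cube_sum 3 5 (-4) (Z L)"
        by (rule cube_sum_3_pairs[OF closed top]; rule small) (simp_all add: 2 cube_sum_simps)
      then have "0 \<le> h L"
        using mono[of "-4"] 2 y6 by simp
      then show ?thesis
        using 2 by (auto simp: \<G>_def y_def)
    next
      case 3
      have "0 \<le> cube_sum 3 5 (-2) (Z L)"
        by (rule cube_sum_3_nonempty[OF closed top]; rule small) (simp_all add: 3 cube_sum_simps)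
      then have "0 \<le> h L"
        using mono[of "-2"] 3 y6 by simp
      then show ?thesis
        using 3 by (auto simp: \<G>_def y_def)
    next
      case 4
      have "- 5 * of_bool (L \<in> \<G>) \<le> h L"
      proof (cases "L \<in> \<A>")
        case True
        then have "L \<in> \<G>"
          using 4 L by (simp add: \<G>_def)
        then show ?thesis
          using mono[of 0] cube_sum_3_all(1)[OF closed top] 4 y6 by simp
      next
        case False
        then have "0 \<le> cube_sum 3 5 (-2) (Z L)"
          using cube_sum_3_nonempty[OF closed top] Z0 by simp
        then show ?thesis
          using mono[of "-2"] 4 y6 by (simp add: of_bool_def)
      qed
      then show ?thesis
        using 4 by (auto simp: y_def)
    next
      case 5
      have "2 * y * of_bool (L = Y \<and> 5 \<le> y) \<le> h L"
      proof (cases "L = Y \<and> 5 \<le> y")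
        case True
        then have "y = 5 \<or> y = 6" "2 * int (card L) - y = y"
          using y6 by (auto simp: y_def)
        then show ?thesis
          using mono[of y] cube_sum_3_all(3,4)[OF closed top] True by auto
      next
        case False
        moreover have "0 \<le> h L"
          using mono[of 2] cube_sum_3_all(2)[OF closed top] 5 y6 by simp
        ultimately show ?thesis
          by auto
      qed
      then show ?thesis
        using 5 by (auto simp: \<G>_def)
    qed
  qed
  have delta: "(\<Sum>L\<in>\<L>. of_bool (L = X \<and> P)) = (of_bool P :: int)" if "X \<in> \<L>" for X P
    using that fin(1) by (cases P) (simp_all add: of_bool_def)
  have "(\<Sum>L\<in>\<L>. of_bool (L \<in> \<G>)) = int (card \<G>)"
    using fin(1) by (simp add: of_bool_def sum.If_cases \<G>_def Int_def)
  then have "(\<Sum>L\<in>\<L>. 2 * y * of_bool (L = Y \<and> 5 \<le> y) - 2 * y * of_bool (L = {}) - 5 * of_bool (L \<in> \<G>))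
      = 2 * y * of_bool (5 \<le> y) - 2 * y - 5 * int (card \<G>)"
    using delta[of Y "5 \<le> y"] delta[of "{}" True] fibre_base_cases[OF F(1)]
    by (simp add: sum_subtractf \<L>_def Y_def flip: sum_distrib_left)
  moreover have "(\<Sum>L\<in>\<L>. 2 * y * of_bool (L = Y \<and> 5 \<le> y) - 2 * y * of_bool (L = {}) - 5 * of_bool (L \<in> \<G>))
      \<le> (\<Sum>L\<in>\<L>. h L)"
    by (rule sum_mono) (rule lower)
  ultimately have count: "15 + y \<le> 2 * y - 2 * y * of_bool (5 \<le> y) + 5 * int (card \<G>)"
    using total by linarith
  \<comment> \<open>For y = 6 the count reads 21 \<le> 5|\<G>|, for y = 5 it reads 20 \<le> 5|\<G>|,
    and for y \<le> 4 the left side is 15 - y \<ge> 11.\<close>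
  have "\<And>G. G \<in> \<G> \<Longrightarrow> G \<subseteq> Y \<and> card G = 3" "card Y \<le> 6" "3 \<le> card \<G>" "card Y = 6 \<Longrightarrow> 5 \<le> card \<G>"
    using LY y6 count by (auto simp: \<G>_def y_def of_bool_def split: if_splits)
  then obtain A B C where "A \<in> \<G>" "B \<in> \<G>" "C \<in> \<G>" "A \<noteq> B" "A \<noteq> C" "B \<noteq> C" "card (A \<union> B \<union> C) \<le> 5"
    using three_triples_in_five[OF fin(2), of \<G>] by metis
  then show False
    using no_three_triples[of A B C] by (simp add: \<G>_def)
qed

lemma no_min_4:
  assumes F: "F \<in> \<A>" "card F = 4" and min: "\<And>A. A \<in> \<A> \<Longrightarrow> A \<noteq> {} \<Longrightarrow> 4 \<le> card A"
    and nine: "card (\<Union>\<A>) \<le> 9"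
  shows False
proof -
  obtain e where "bij_betw e {0..<4 :: nat} F"
    using ex_bij_betw_nat_finite[OF finite_mem[OF F(1)]] F(2) by auto
  then have inj: "inj_on e {..<4}" and Fe: "F = e ` {..<4}"
    by (auto simp: bij_betw_def atLeast0LessThan)
  define y where "y = int (card (\<Union>\<A> - F))"
  define \<L> where "\<L> = (\<lambda>A. A - F) ` \<A>"
  define Z where "Z L n = (of_bool (sel e 4 n \<union> L \<in> \<A>) :: int)" for L n
  define h where "h L = cube_sum 4 3 (2 * int (card L) - y) (Z L)" for L
  have fin: "finite \<L>" "finite (\<Union>\<A> - F)"
    using finite_family finite_ground by (auto simp: \<L>_def)
  have sub: "F \<subseteq> \<Union>\<A>"
    using F by blast
  have y5: "y \<le> 5"
    using nine F(2) finite_mem[OF F(1)] card_Diff_subset[OF _ sub] by (simp add: y_def)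
  have total: "(\<Sum>L\<in>\<L>. h L) \<le> - (12 + y)"
    using cube_sum_le[OF inj Fe sub, of 3] by (simp add: h_def Z_def[abs_def] \<L>_def y_def)
  \<comment> \<open>Only the empty trace can be negative, so the total is at least -2y; the upper
    bound -(12 + y) would then need y \<ge> 12.\<close>
  have lower: "- 2 * y * of_bool (L = {}) \<le> h L" if L: "L \<in> \<L>" for L
  proof -
    have closed: "bit_closed (Z L) {}"
      unfolding Z_def by (rule bit_closed_fibre) simp
    have "sel e 4 15 = F"
      using sel_mask[of e 4] Fe by simp
    then have top: "Z L 15 = 1"
      using fibre_top F(1) L by (simp add: Z_def \<L>_def)
    have small: "Z L n = 0" if "0 < (\<Sum>i<4. of_bool (bit n i)) + int (card L)"
      "(\<Sum>i<4. of_bool (bit n i)) + int (card L) < 4" for n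
      using fibre_small[OF inj min, of L n] that L by (simp add: Z_def \<L>_def Fe)
    have mono: "cube_sum 4 3 c (Z L) \<le> h L" if "c \<le> 2 * int (card L) - y" for c
      unfolding h_def by (rule cube_sum_mono) (use that in \<open>auto simp: Z_def\<close>)
    have "L \<subseteq> \<Union>\<A> - F"
      using L by (auto simp: \<L>_def)
    then consider "L = {}" | "card L = 1" | "card L = 2" | "card L = 3" | "4 \<le> card L"
      using finite_subset[OF _ fin(2), of L] by (cases "card L = 0") fastforce+
    then show ?thesis
    proof cases
      case 1
      have "Z L n = 0" if "n \<in> {1, 2, 3, 4, 5, 6, 7, 8, 9, 10, 11, 12, 13, 14}" for n
        using that by (intro small) (auto simp: 1 cube_sum_simps)
      moreover have "Z L 0 = 1"
        using empty_mem 1 by (simp add: Z_def)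
      ultimately have "h L = 2 * - y"
        unfolding h_def using cube_sum_4_empty[OF closed top, of "- y"] 1 by simp
      then show ?thesis
        using 1 by simp
    next
      case 2
      have "0 \<le> cube_sum 4 3 (-3) (Z L)"
        by (rule cube_sum_4_triples[OF closed top]; rule small) (auto simp: 2 cube_sum_simps)
      then show ?thesis
        using mono[of "-3"] 2 y5 by (auto simp: of_bool_def)
    next
      case 3
      have "0 \<le> cube_sum 4 3 (-1) (Z L)"
        by (rule cube_sum_4_pairs[OF closed top]; rule small) (simp_all add: 3 cube_sum_simps)
      then show ?thesis
        using mono[of "-1"] 3 y5 by (auto simp: of_bool_def)
    next
      case 4
      have "0 \<le> cube_sum 4 3 1 (Z L)"
        by (rule cube_sum_4_nonempty[OF closed top]; rule small) (simp_all add: 4 cube_sum_simps)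
      then show ?thesis
        using mono[of 1] 4 y5 by (auto simp: of_bool_def)
    next
      case 5
      then show ?thesis
        using mono[of 3] cube_sum_4_all[OF closed top] y5 by (auto simp: of_bool_def)
    qed
  qed
  have "(\<Sum>L\<in>\<L>. - 2 * y * of_bool (L = {})) = - 2 * y"
    using fibre_base_cases(1)[OF F(1)] fin(1) by (simp add: of_bool_def if_distrib \<L>_def cong: if_cong)
  moreover have "(\<Sum>L\<in>\<L>. - 2 * y * of_bool (L = {})) \<le> (\<Sum>L\<in>\<L>. h L)"
    by (rule sum_mono) (rule lower)
  ultimately show False
    using total y5 by linarith
qed

text \<open>With uniform weights every nonempty member contributes at least 2 * 5 - 9 = 1 and the
  empty set -n. As \<open>F\<close> is nonempty, the total exceeds the bound -n.\<close>

lemma no_min_5: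
  assumes F: "F \<in> \<A>" "F \<noteq> {}" and min: "\<And>A. A \<in> \<A> \<Longrightarrow> A \<noteq> {} \<Longrightarrow> 5 \<le> card A"
    and nine: "card (\<Union>\<A>) \<le> 9"
  shows False
proof -
  define n where "n = int (card (\<Union>\<A>))"
  have size: "(\<Sum>x\<in>\<Union>\<A>. 1 * (2 * of_bool (x \<in> A) - 1)) = 2 * int (card A) - n" if "A \<in> \<A>" for A
  proof -
    have "\<Union>\<A> \<inter> {x. x \<in> A} = A"
      using that by auto
    then show ?thesis
      using finite_ground by (simp add: sum_subtractf of_bool_def sum.If_cases n_def flip: sum_distrib_left)
  qed
  have "(\<Sum>A\<in>\<A>. 2 * int (card A) - n) \<le> - n"
    using weighted_sum_le[of "\<Union>\<A>" "\<lambda>_. 1" "\<lambda>x. x"] size by (simp add: n_def)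
  moreover have "of_bool (A \<noteq> {}) - n * of_bool (A = {}) \<le> 2 * int (card A) - n" if "A \<in> \<A>" for A
    using min[OF that] nine by (cases "A = {}") (auto simp: n_def)
  then have "(\<Sum>A\<in>\<A>. of_bool (A \<noteq> {}) - n * of_bool (A = {})) \<le> (\<Sum>A\<in>\<A>. 2 * int (card A) - n)"
    by (rule sum_mono)
  moreover have "(\<Sum>A\<in>\<A>. n * of_bool (A = {})) = n"
    using empty_mem finite_family by (simp add: of_bool_def if_distrib cong: if_cong)
  moreover have "1 \<le> (\<Sum>A\<in>\<A>. of_bool (A \<noteq> {}) :: int)"
    using member_le_sum[of F \<A> "\<lambda>A. of_bool (A \<noteq> {}) :: int"] F finite_family by simp
  ultimately show False
    by (simp add: sum_subtractf)
qed

lemma card_ground_ge_10: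
  assumes "\<Union>\<A> \<noteq> {}"
  shows "10 \<le> card (\<Union>\<A>)"
proof (rule ccontr)
  assume "\<not> 10 \<le> card (\<Union>\<A>)"
  then have nine: "card (\<Union>\<A>) \<le> 9"
    by simp
  obtain F where F: "F \<in> \<A>" "F \<noteq> {}" and min: "\<And>A. A \<in> \<A> \<Longrightarrow> A \<noteq> {} \<Longrightarrow> card F \<le> card A"
    using ex_has_least_nat[of "\<lambda>A. A \<in> \<A> \<and> A \<noteq> {}" _ card] assms by blast
  have "card F \<noteq> 0" "card F \<noteq> 1" "card F \<noteq> 2"
    using F finite_mem no_singleton no_pair by (auto simp: card_1_singleton_iff card_2_iff)
  then consider "card F = 3" | "card F = 4" | "5 \<le> card F"
    by linarith
  then show False
    by cases (use no_min_3[OF F(1)] no_min_4[OF F(1)] no_min_5[OF F] min nine order_trans in metis)+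
qed

end

section \<open>Families on nine points\<close>

theorem theorem3:
  fixes \<A> :: "nat set set"
  assumes "\<And>A. A \<in> \<A> \<Longrightarrow> A \<subseteq> {1..9}"
    and "union_closed \<A>"
    and "\<exists>A\<in>\<A>. A \<noteq> {}"
  shows "\<exists>x\<in>{1..9}. 2 * card {A \<in> \<A>. x \<in> A} \<ge> card \<A>"
proof (rule ccontr)
  assume none: "\<not> ?thesis"
  have ground: "\<Union>(insert {} \<A>) \<subseteq> {1..9}"
    using assms(1) by auto
  then have fin: "finite \<A>"
    by (metis Sup_insert finite_UnionD finite_atLeastAtMost finite_subset sup_bot_left)
  \<comment> \<open>Inserting \<open>{}\<close> leaves the members containing x unchanged and cannot
    shrink the family, so x stays rare.\<close>
  interpret counterexample "insert {} \<A>"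
  proof
    show "finite (\<Union>(insert {} \<A>))"
      using ground by (rule finite_subset) simp
    show "union_closed (insert {} \<A>)"
      using assms(2) by (auto simp: union_closed_def)
    fix x assume "x \<in> \<Union>(insert {} \<A>)"
    then have "2 * card {A \<in> \<A>. x \<in> A} < card \<A>"
      using none ground by (meson not_le subsetD)
    moreover have "{A \<in> insert {} \<A>. x \<in> A} = {A \<in> \<A>. x \<in> A}"
      by auto
    moreover have "card \<A> \<le> card (insert {} \<A>)"
      using fin by (simp add: card_insert_le)
    ultimately show "excess (insert {} \<A>) x < 0"
      by (simp add: excess_def)
  qed simp
  have "10 \<le> card {1..9::nat}"
    using card_ground_ge_10 assms(3) card_mono[OF _ ground] by fastforce
  then show False
    by simp
qed

end
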